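(* Let $(\mathcal{L}_n)_{n\ge 0}$ be a Lucas-type sequence with data $p_0,p_1,d,g,\alpha$ (as defined in the context). Let $\beta=\mathrm{lc}(d)$, $\eta=\deg(d)$, $\omega=\deg(g)$, $\rho=\mathrm{Res}(g,d)$. Then for all positive integers $m,n$, $$\mathrm{Res}(\mathcal{L}_m,\mathcal{L}_n)=\begin{cases}0 & \text{if }E_2(n)=E_2(m),\\ \alpha^{-\eta(n+m)}\,2^{\eta\gcd(m,n)}\left((-1)^{\eta\omega}\beta^{2\eta-\omega}\rho\right)^{nm/2} & \text{if }E_2(n)\neq E_2(m).\end{cases}$$
   Context: A Lucas-type sequence is given by a constant $p_0$ with $|p_0|\in\{1,2\}$, the integer $\alpha=2/p_0$, and non-zero polynomials $p_1,d,g\in\mathbb{Q}[x]$ with $d=\alpha p_1$, via $\mathcal{L}_0=p_0$, $\mathcal{L}_1=p_1$, $\mathcal{L}_n=d\,\mathcal{L}_{n-1}+g\,\mathcal{L}_{n-2}$ for $n\ge 2$. Standing assumptions: $\gcd(d,g)=1$, $\deg(g)<\deg(d)$, $\gcd(p_0,p_1)=\gcd(p_0,d)=\gcd(p_0,g)=1$, and $\deg(\mathcal{L}_1)\ge 1$. For a positive integer $n$, $E_2(n)$ is the largest integer $k$ with $2^k\mid n$ (the 2-adic valuation). $\mathrm{lc}(P)$ and $\deg(P)$ denote the leading coefficient and degree of $P$. For non-zero $P,Q\in\mathbb{Q}[x]$ of degrees $n,m$ with leading coefficients $a_n,b_m$ and complex roots $x_1,\dots,x_n$ and $y_1,\dots,y_m$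 (with multiplicity), $\mathrm{Res}(P,Q)$ is the determinant of the Sylvester matrix of $P,Q$; equivalently $\mathrm{Res}(P,Q)=a_n^m b_m^n\prod_{i,j}(x_i-y_j)=a_n^m\prod_i Q(x_i)$. In particular $\mathrm{Res}(k,f)=\mathrm{Res}(f,k)=k^{\deg f}$ for a non-zero constant $k$. *)

theory Defs
  imports
    "HOL-Computational_Algebra.Computational_Algebra"
    "HOL-Computational_Algebra.Field_as_Ring"
    "Subresultants.Resultant_Prelim"
begin

fun lucas_seq ::
  "rat \<Rightarrow> rat poly \<Rightarrow> rat poly \<Rightarrow> rat poly \<Rightarrow> nat \<Rightarrow> rat poly" where
  "lucas_seq p0 p1 d g 0 = [:p0:]"
| "lucas_seq p0 p1 d g (Suc 0) = p1"
| "lucas_seq p0 p1 d g (Suc (Suc n)) =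
     d * lucas_seq p0 p1 d g (Suc n) + g * lucas_seq p0 p1 d g n"

(* The gcds are taken in the ring of rational polynomials. There p0 is a unit, so the last
   three conditions hold automatically; they are kept because they belong to the definition. *)
definition lucas_type_data ::
  "rat \<Rightarrow> rat poly \<Rightarrow> rat poly \<Rightarrow> rat poly \<Rightarrow> int \<Rightarrow> bool" where
  "lucas_type_data p0 p1 d g \<alpha> \<longleftrightarrow>
     \<bar>p0\<bar> \<in> {1, 2} \<and> of_int \<alpha> = 2 / p0 \<and>
     p1 \<noteq> 0 \<and> d \<noteq> 0 \<and> g \<noteq> 0 \<and>
     d = Polynomial.smult (of_int \<alpha>) p1 \<and>
     degree g < degree d \<and> degree p1 \<ge> 1 \<and>
     gcd d g = 1 \<and>
     gcd [:p0:] p1 = 1 \<and> gcd [:p0:] d = 1 \<and> gcd [:p0:] g = 1"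

end

theory Submission
  imports Defs "Subresultants.Subresultant"
begin

text \<open>Since \<open>\<alpha> * p0 = 2\<close>, the rescaled sequence \<open>\<alpha> L\<^sub>n\<close> is the Lucas sequence \<open>V\<^sub>n\<close> with
  \<open>V\<^sub>0 = 2\<close> and \<open>V\<^sub>1 = d\<close>, and \<open>V\<^sub>c\<^sub>+\<^sub>2\<^sub>k = V\<^sub>c\<^sub>+\<^sub>k V\<^sub>k - (-g)\<^sup>k V\<^sub>c\<close>. Reducing \<open>V\<^sub>n\<close> modulo
  \<open>V\<^sub>m\<close> therefore replaces \<open>Res(V\<^sub>m, V\<^sub>n)\<close> by \<open>Res(V\<^sub>m, V\<^sub>j)\<close> with \<open>j = \<bar>n - 2m\<bar>\<close>, up to powers of
  the leading coefficient and of \<open>Res(V\<^sub>m, g)\<close>; the latter is known because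
  \<open>V\<^sub>m\<close> is congruent to \<open>d\<^sup>m\<close> modulo \<open>g\<close>. This Euclidean descent keeps
  \<open>gcd(m, n)\<close> and the parities of \<open>m / gcd(m, n)\<close> and \<open>n / gcd(m, n)\<close>, and it stops either at
  \<open>V\<^sub>0 = 2\<close> or at two equal indices; the latter happens exactly when \<open>m\<close> and \<open>n\<close>
  have the same 2-adic valuation.\<close>

section \<open>Resultants\<close>

lemma resultant_self_mult_right:
  fixes p s :: "'a :: field poly"
  assumes "degree p > 0"
  shows "resultant p (p * s) = 0"
proof (cases "s = 0")
  case True
  then show ?thesis using assms by simp
next
  case False
  have "p \<noteq> 0" using assms by auto
  then have "degree (p * s) \<ge> degree p" using False by (simp add: degree_mult_eq)
  from subresultant_product[of "p * s" s p 0, OF mult.commute this]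
  have "resultant (p * s) p = 0"
    using assms by (simp add: coeff_subresultant_0_0_resultant[symmetric])
  then show ?thesis by (subst resultant_swap) simp
qed

lemma resultant_mod_less:
  fixes p q r s :: "'a :: field poly"
  assumes q: "q = p * s + r" and "r \<noteq> 0" "degree r < degree p" "degree p \<le> degree q"
  shows "resultant p q = lead_coeff p ^ (degree q - degree r) * resultant p r"
proof -
  have eq: "q + (- s) * p = r" using q by (simp add: algebra_simps)
  have "resultant q p =
    (-1) ^ (degree q * degree p) * (lead_coeff p ^ (degree q - degree r) * resultant p r)"
  \<comment> \<open>Index 0 lies strictly below \<open>degree r\<close> unless \<open>r\<close> is
    constant; that boundary case has its own subresultant identity.\<close>
  proof (cases "degree r = 0")
    case False
    then show ?thesis
      using arg_cong[OF BT_lemma_1_12[OF eq, of 0], of "\<lambda>x. coeff x 0"] assms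
      by (simp add: coeff_subresultant_0_0_resultant)
  next
    case True
    then obtain c where c: "r = [:c:]" by (metis degree_eq_zeroE)
    have "coeff (subresultant (degree r) q p) 0 =
      (-1) ^ (degree q * degree p) * lead_coeff p ^ degree q * c ^ (degree p - 1) * c"
      using arg_cong[OF BT_lemma_1_13[OF eq], of "\<lambda>x. coeff x 0"] assms c by simp
    moreover have "c ^ (degree p - 1) * c = c ^ degree p"
      using assms(3) by (metis power_minus_mult less_nat_zero_code not_gr_zero)
    ultimately show ?thesis
      using True c by (simp add: coeff_subresultant_0_0_resultant mult.assoc)
  qed
  then show ?thesis
    by (subst resultant_swap) (simp add: mult.commute[of "degree p"] flip: power_add mult.assoc)
qed

text \<open>If both degrees reach \<open>degree p\<close>, then \<open>q\<close> and
  \<open>r\<close> reduce to the same true remainder. Later uses need this generality: there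
  \<open>r\<close> is only congruent to \<open>q\<close> and can have larger degree than
  \<open>p\<close>.\<close>

lemma resultant_mod:
  fixes p q r s :: "'a :: field poly"
  assumes q: "q = p * s + r" and r: "r \<noteq> 0" and le: "degree r \<le> degree q"
  shows "resultant p q = lead_coeff p ^ (degree q - degree r) * resultant p r"
proof -
  consider "degree p = 0" | "degree p > 0" "degree q < degree p"
    | "degree p > 0" "degree p \<le> degree q" "degree r < degree p"
    | "degree p > 0" "degree p \<le> degree q" "degree p \<le> degree r"
    by linarith
  then show ?thesis
  proof cases
    case 1
    then obtain c where "p = [:c:]" by (metis degree_eq_zeroE)
    then show ?thesis using le by (simp flip: power_add)
  next
    case 2
    have "s = 0"
    proof (rule ccontr)
      assume "s \<noteq> 0"
      moreover have "p \<noteq> 0" using 2 by auto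
      ultimately have "degree p \<le> degree (p * s)" by (simp add: degree_mult_eq)
      moreover have "p * s = q - r" using q by simp
      moreover have "degree (q - r) < degree p" using 2 le by (intro degree_diff_less) auto
      ultimately show False by simp
    qed
    then show ?thesis using q by simp
  next
    case 3
    then show ?thesis using q r by (intro resultant_mod_less)
  next
    case 4
    define t where "t = r mod p"
    have r': "r = p * (r div p) + t" by (simp add: t_def)
    have q': "q = p * (s + r div p) + t" using q r' by (metis add.assoc distrib_left)
    show ?thesis
    proof (cases "t = 0")
      case True
      have "resultant p q = 0" using q' True resultant_self_mult_right[OF 4(1)] by simp
      moreover have "resultant p r = 0"
        using r' True resultant_self_mult_right[OF 4(1)] by (metis add.right_neutral)
      ultimately show ?thesis by simp
    next
      case False
      have lt: "degree t < degree p"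
        using 4(1) unfolding t_def by (metis degree_0 degree_mod_less' less_irrefl False t_def)
      have "degree q - degree t = (degree q - degree r) + (degree r - degree t)"
        using lt 4 le by linarith
      then show ?thesis
        using resultant_mod_less[OF q' False lt 4(2)] resultant_mod_less[OF r' False lt 4(3)]
        by (simp add: power_add)
    qed
  qed
qed

text \<open>Both sides scale alike when \<open>p\<close> is reduced modulo \<open>q\<close>; afterwards \<open>q\<close> can be reduced
  modulo \<open>(x - a) p\<close>, which keeps its value at \<open>a\<close> and lowers its degree.\<close>
lemma resultant_linear_mult_left:
  fixes p q :: "'a :: field poly"
  assumes "p \<noteq> 0" "q \<noteq> 0"
  shows "resultant ([:- a, 1:] * p) q = poly q a * resultant p q"
  using assms
proof (induction "degree q" arbitrary: p q rule: less_induct)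
  case less
  let ?l = "[:- a, 1:]"
  have deg_l: "degree (?l * x) = Suc (degree x)" if "x \<noteq> 0" for x
    using that by (subst degree_mult_eq) auto
  have lc_l: "lead_coeff (?l * x) = lead_coeff x" for x
    by (subst lead_coeff_mult) simp
  show ?case
  proof (cases "degree q = 0")
    case True
    then obtain c where "q = [:c:]" by (metis degree_eq_zeroE)
    then show ?thesis using deg_l[OF less.prems(1)] by (simp del: mult_pCons_left)
  next
    case deg_q: False
    have small: "resultant (?l * r) q = poly q a * resultant r q"
      if r: "r \<noteq> 0" "degree r < degree q" for r
    proof -
      define u where "u = q mod (?l * r)"
      define s where "s = q div (?l * r)"
      \<comment> \<open>One remainder serves two moduli with equal leading coefficients, so both
        resultants acquire the same factor.\<close>
      have q: "q = (?l * r) * s + u" "q = r * (?l * s) + u"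
        using mult_div_mod_eq[of "?l * r" q]
        by (simp_all only: u_def s_def ac_simps)
      have poly_u: "poly q a = poly u a"
        using arg_cong[OF q(1), of "\<lambda>x. poly x a"] by simp
      show ?thesis
      proof (cases "u = 0")
        case True
        have "resultant (?l * r) q = 0"
          using q(1) True resultant_self_mult_right[of "?l * r" s] deg_l[OF r(1)]
          by (metis add.right_neutral zero_less_Suc)
        then show ?thesis using poly_u True by simp
      next
        case False
        have "degree u < Suc (degree r)"
          using degree_mod_less'[of "?l * r" q] False deg_l[OF r(1)] r(1)
          by (metis mult_eq_0_iff pCons_eq_0_iff one_neq_zero u_def)
        then have lt: "degree u < degree q" using r by simp
        from resultant_mod[OF q(1) False] resultant_mod[OF q(2) False] lt
        have "resultant (?l * r) q =
            lead_coeff r ^ (degree q - degree u) * resultant (?l * r) u"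
          "resultant r q = lead_coeff r ^ (degree q - degree u) * resultant r u"
          by (simp_all only: lc_l less_imp_le)
        then show ?thesis
          using less.hyps[OF lt r(1) False] poly_u by (simp del: mult_pCons_left)
      qed
    qed
    define r where "r = p mod q"
    define s where "s = p div q"
    have p: "p = q * s + r" by (simp add: r_def s_def)
    have lp: "?l * p = q * (?l * s) + ?l * r"
      by (subst p) (simp only: distrib_left mult.left_commute)
    show ?thesis
    proof (cases "r = 0")
      case True
      have "resultant p q = 0"
        using p True resultant_self_mult_right[of q s] deg_q
        by (subst resultant_swap) simp
      moreover have "resultant (?l * p) q = 0"
        using resultant_self_mult_right[of q "?l * s"] deg_q
        by (subst resultant_swap, subst lp) (simp add: True del: mult_pCons_left)
      ultimately show ?thesis by simp
    next
      case False
      have lt: "degree r < degree q"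
        using False degree_mod_less'[of q p] less.prems by (simp add: r_def)
      have le: "degree r \<le> degree p"
        using lt mod_poly_less[of p q] unfolding r_def by (cases "degree p < degree q") auto
      have lr: "?l * r \<noteq> 0" using False by (metis mult_eq_0_iff pCons_eq_0_iff one_neq_zero)
      \<comment> \<open>The factor \<open>?l\<close> raises both degrees by one: the sign exponent
        changes by \<open>2 * degree q\<close> and the degree difference not at all, so
        \<open>c\<close> fits both reductions.\<close>
      define c where "c = (-1) ^ (degree p * degree q + degree r * degree q)
        * lead_coeff q ^ (degree p - degree r)"
      have "resultant p q = c * resultant r q"
        using resultant_mod[OF p False le] resultant_swap[of p q] resultant_swap[of q r]
        by (simp add: c_def power_add mult.commute)
      moreover have "resultant (?l * p) q = c * resultant (?l * r) q"
        using resultant_mod[OF lp lr] le resultant_swap[of "?l * p" q]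
          resultant_swap[of q "?l * r"] deg_l[OF False] deg_l[OF less.prems(1)]
        by (simp add: c_def power_add mult.commute del: mult_pCons_left)
      ultimately show ?thesis using small[OF False lt] by (simp del: mult_pCons_left)
    qed
  qed
qed

text \<open>Splitting off the roots \<open>z\<close> of \<open>p\<close> one by one turns the
  resultant into values at \<open>z\<close>, which are multiplicative.\<close>

lemma resultant_mult_right_complex:
  fixes p q r :: "complex poly"
  assumes "p \<noteq> 0" "q \<noteq> 0" "r \<noteq> 0"
  shows "resultant p (q * r) = resultant p q * resultant p r"
  using assms(1)
proof (induction "degree p" arbitrary: p)
  case 0
  then obtain c where "p = [:c:]" by (metis degree_eq_zeroE)
  then show ?case using assms by (simp add: degree_mult_eq power_add)
next
  case (Suc n)
  then have "\<not> constant (poly p)" by (simp add: constant_degree)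
  then obtain z where "poly p z = 0" using fundamental_theorem_of_algebra by blast
  then obtain p' where p: "p = [:- z, 1:] * p'" by (auto simp: poly_eq_0_iff_dvd)
  with Suc.prems have p': "p' \<noteq> 0" by auto
  with p Suc.hyps(2) have "n = degree p'" by (auto simp: degree_mult_eq simp del: mult_pCons_left)
  from Suc.hyps(1)[OF this p'] show ?case
    using assms resultant_linear_mult_left[OF p', of "q * r" z]
      resultant_linear_mult_left[OF p', of q z] resultant_linear_mult_left[OF p', of r z]
    unfolding p by (simp del: mult_pCons_left)
qed

lemma resultant_mult_right:
  fixes p q r :: "rat poly"
  assumes "p \<noteq> 0" "q \<noteq> 0" "r \<noteq> 0"
  shows "resultant p (q * r) = resultant p q * resultant p r"
proof -
  interpret h: map_poly_inj_comm_ring_hom "of_rat :: rat \<Rightarrow> complex" ..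
  have "(of_rat (resultant p (q * r)) :: complex) = of_rat (resultant p q * resultant p r)"
    using assms resultant_mult_right_complex
      [of "map_poly of_rat p" "map_poly of_rat q" "map_poly of_rat r"]
    by (simp add: of_rat_mult of_rat_hom.resultant_hom flip: h.hom_mult)
  then show ?thesis by simp
qed

lemma resultant_power_right:
  fixes p q :: "rat poly"
  assumes "p \<noteq> 0" "q \<noteq> 0"
  shows "resultant p (q ^ n) = resultant p q ^ n"
  by (induction n) (use assms in \<open>simp_all add: resultant_mult_right\<close>)

section \<open>Parity of the cofactors of the greatest common divisor\<close>

text \<open>Stands in for equal 2-adic valuations because the descent can reach index 0. There
  \<open>multiplicity 2 0 = 0\<close> would give the wrong answer against an odd index, whereas here
  the cofactor 0 is even.\<close>

definition odd_cofactors :: "nat \<Rightarrow> nat \<Rightarrow> bool" where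
  "odd_cofactors m n \<longleftrightarrow> odd (m div gcd m n) \<and> odd (n div gcd m n)"

lemma odd_cofactors_commute: "odd_cofactors m n \<longleftrightarrow> odd_cofactors n m"
  by (auto simp: odd_cofactors_def gcd.commute)

text \<open>The gcd contributes equally to both valuations, and the coprime cofactors cannot both be
  even.\<close>

lemma multiplicity_two_eq_iff:
  assumes "m > 0" "n > 0"
  shows "multiplicity 2 n = multiplicity 2 m \<longleftrightarrow> odd_cofactors m n"
proof -
  define h where "h = gcd m n"
  define m' where "m' = m div h"
  define n' where "n' = n div h"
  have mn: "m = h * m'" "n = h * n'" by (simp_all add: h_def m'_def n'_def)
  with assms have pos: "h > 0" "m' > 0" "n' > 0" by (auto intro!: Nat.gr0I)
  have "coprime m' n'"
    unfolding m'_def n'_def h_def using assms by (intro div_gcd_coprime) auto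
  then have "odd m' \<or> odd n'"
    by (metis coprime_common_divisor_nat numeral_eq_one_iff semiring_norm(85))
  then have "multiplicity 2 n' = multiplicity 2 m' \<longleftrightarrow> odd m' \<and> odd n'"
    using pos by (metis not_dvd_imp_multiplicity_0 multiplicity_eq_zero_iff odd_one neq0_conv)
  moreover have "multiplicity 2 m = multiplicity 2 h + multiplicity 2 m'"
    "multiplicity 2 n = multiplicity 2 h + multiplicity 2 n'"
    unfolding mn using pos by (simp_all add: prime_elem_multiplicity_mult_distrib)
  ultimately show ?thesis by (simp add: odd_cofactors_def m'_def n'_def h_def)
qed

section \<open>The normalized sequence\<close>

lemma lucas_seq_scale:
  assumes "a * p0 = 2" "d = Polynomial.smult a p1"
  shows "lucas_seq 2 d d g n = Polynomial.smult a (lucas_seq p0 p1 d g n)"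
  by (induction n rule: induct_nat_012) (use assms in \<open>simp_all add: smult_add_right\<close>)

context
  fixes d g :: "rat poly"
begin

abbreviation V :: "nat \<Rightarrow> rat poly" where
  "V n \<equiv> lucas_seq 2 d d g n"

text \<open>If x, y are the roots of t^2 - d t - g, then \<open>V n\<close> is x^n + y^n and x y =
  -g, so this is the product rule for power sums. The induction avoids the roots.\<close>

lemma V_reduction: "V (c + 2 * k) = V (c + k) * V k - (- g) ^ k * V c"
proof (induction k arbitrary: c rule: induct_nat_012)
  case 0
  have "V 0 = 2" by (simp add: numeral_poly)
  then show ?case by (simp add: algebra_simps del: lucas_seq.simps)
next
  case 1
  show ?case by (simp add: algebra_simps)
next
  case (ge2 k)
  \<comment> \<open>The offset grows by 1 and 2 so that the induction hypotheses at
    \<open>Suc k\<close> and \<open>k\<close> apply.\<close>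
  have "V (c + 2 * Suc (Suc k)) = d * V (Suc c + 2 * Suc k) + g * V (Suc (Suc c) + 2 * k)"
    by simp
  also have "\<dots> = V (c + Suc (Suc k)) * V (Suc (Suc k)) - (- g) ^ Suc (Suc k) * V c"
    unfolding ge2 by (simp add: algebra_simps)
  finally show ?case .
qed

lemma V_cong_power:
  assumes "n > 0"
  obtains s where "V n = g * s + d ^ n"
proof -
  have "\<exists>s. V (Suc n) = g * s + d ^ Suc n" for n
  proof (induction n)
    case 0
    have "V (Suc 0) = g * 0 + d ^ Suc 0" by simp
    then show ?case by blast
  next
    case (Suc n)
    then obtain s where "V (Suc n) = g * s + d ^ Suc n" by blast
    then have "V (Suc (Suc n)) = g * (d * s + V n) + d ^ Suc (Suc n)"
      by (simp add: algebra_simps)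
    then show ?case by blast
  qed
  with assms that show thesis by (metis gr0_conv_Suc)
qed

section \<open>Closed form and Euclidean descent for the normalized sequence\<close>

definition res_base :: rat where
  "res_base =
    (-1) ^ (degree d * degree g) * lead_coeff d ^ (2 * degree d - degree g) * resultant g d"

text \<open>The value to be shown for the resultant of \<open>V m\<close> and \<open>V n\<close>,
  meant to hold also when one index is 0.\<close>

definition res_value :: "nat \<Rightarrow> nat \<Rightarrow> rat" where
  "res_value m n = (if odd_cofactors m n then 0
    else 2 ^ (degree d * gcd m n) * res_base ^ (m * n div 2))"

context
  assumes deg_less: "degree g < degree d"
begin

text \<open>The summand \<open>d * V (Suc n)\<close> dominates. Both claims go through one induction
  because the leading coefficient shows that \<open>V (Suc n)\<close> is non-zero, which the degree
  of the product needs.\<close>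

lemma degree_lead_coeff_V:
  "degree (V n) = n * degree d \<and> lead_coeff (V n) = (if n = 0 then 2 else lead_coeff d ^ n)"
proof (induction n rule: induct_nat_012)
  case 0
  show ?case by simp
next
  case 1
  show ?case by simp
next
  case (ge2 n)
  have d: "d \<noteq> 0" using deg_less by auto
  have nz: "V (Suc n) \<noteq> 0" using ge2 d
    by (metis leading_coeff_0_iff nat.distinct(1) power_not_zero)
  have deg: "degree (d * V (Suc n)) = Suc (Suc n) * degree d"
    using d nz ge2 by (simp add: degree_mult_eq)
  have "degree (g * V n) \<le> degree g + n * degree d"
    using degree_mult_le[of g "V n"] ge2 by simp
  then have lt: "degree (g * V n) < degree (d * V (Suc n))"
    using deg_less unfolding deg by simp
  have "lead_coeff (d * V (Suc n)) = lead_coeff d ^ Suc (Suc n)"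
    unfolding lead_coeff_mult using conjunct2[OF ge2(2)]
    by (simp only: nat.distinct if_False power_Suc)
  then show ?case
    using degree_add_eq_left[OF lt] lead_coeff_add_le[OF lt] deg by (simp add: add.commute)
qed

lemmas degree_V = conjunct1[OF degree_lead_coeff_V]

lemma lead_coeff_V: "n > 0 \<Longrightarrow> lead_coeff (V n) = lead_coeff d ^ n"
  using conjunct2[OF degree_lead_coeff_V, of n] by simp

lemma V_nonzero: "V n \<noteq> 0"
proof -
  have "d \<noteq> 0" using deg_less by auto
  then have "lead_coeff (V n) \<noteq> 0" using conjunct2[OF degree_lead_coeff_V, of n] by simp
  then show ?thesis by auto
qed

context
  assumes g_nonzero: "g \<noteq> 0"
begin

text \<open>The congruent power \<open>d ^ n\<close> has the same degree as \<open>V n\<close>, so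
  no power of the leading coefficient of \<open>g\<close> appears.\<close>

lemma resultant_g_V:
  assumes "n > 0"
  shows "resultant g (V n) = resultant g d ^ n"
proof -
  obtain s where s: "V n = g * s + d ^ n" using V_cong_power[OF assms] .
  have "d \<noteq> 0" using deg_less by auto
  moreover have "degree (d ^ n) = degree (V n)"
    using degree_V[of n] \<open>d \<noteq> 0\<close> by (simp add: degree_power_eq)
  ultimately show ?thesis
    using resultant_mod[OF s] g_nonzero by (simp add: resultant_power_right)
qed

text \<open>Either factor of the product in \<open>V_reduction\<close> can be the modulus. With n =
  c + 2k, the choice m = k means c = n - 2m, and m = c + k means c = 2m - n.\<close>

lemma resultant_V_reduction:
  assumes m: "m = k \<or> m = c + k" and "m > 0"
  shows "resultant (V m) (V (c + 2 * k)) =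
    (-1) ^ (Suc k * m * degree d) * res_base ^ (m * k) * resultant (V m) (V c)"
proof -
  define e :: rat where "e = (-1) ^ Suc k"
  define u where "u = Polynomial.smult e (g ^ k * V c)"
  have e: "e \<noteq> 0" by (simp add: e_def)
  have "(- g) ^ k = Polynomial.smult ((-1) ^ k) (g ^ k)"
    by (metis smult_1_left smult_minus_left smult_power)
  then have u: "u = - ((- g) ^ k * V c)" by (simp add: u_def e_def)
  obtain s where "V (c + 2 * k) = V m * s - (- g) ^ k * V c"
    using m by (metis V_reduction mult.commute)
  then have eq: "V (c + 2 * k) = V m * s + u" by (simp add: u)
  have deg_u: "degree u = k * degree g + c * degree d"
    using e g_nonzero V_nonzero by (simp add: u_def degree_mult_eq degree_power_eq degree_V)
  have u_nz: "u \<noteq> 0" using e g_nonzero V_nonzero by (simp add: u_def)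
  \<comment> \<open>The terms in \<open>c\<close> cancel, leaving \<open>k\<close> times the
    exponent of the leading coefficient in \<open>res_base\<close>.\<close>
  have diff: "degree (V (c + 2 * k)) - degree u = k * (2 * degree d - degree g)"
    unfolding degree_V deg_u by (simp add: algebra_simps diff_mult_distrib2)
  have le: "degree u \<le> degree (V (c + 2 * k))"
    unfolding degree_V deg_u add_mult_distrib mult.assoc
    using mult_le_mono2[OF less_imp_le[OF deg_less], of k] by linarith
  have "resultant (V m) (V (c + 2 * k)) =
      lead_coeff d ^ (m * (k * (2 * degree d - degree g))) * resultant (V m) u"
    using resultant_mod[OF eq u_nz le] lead_coeff_V[OF \<open>m > 0\<close>]
    unfolding diff by (simp add: power_mult)
  also have "resultant (V m) u =
      e ^ (m * degree d) * (resultant (V m) g ^ k * resultant (V m) (V c))"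
    using e g_nonzero V_nonzero degree_V[of m]
    by (simp add: u_def resultant_smult_right resultant_mult_right resultant_power_right)
  also have "resultant (V m) g = (-1) ^ (m * degree d * degree g) * resultant g d ^ m"
    using resultant_swap[of "V m" g] resultant_g_V[OF \<open>m > 0\<close>] degree_V[of m] by simp
  also have "e ^ (m * degree d) = (-1) ^ (Suc k * m * degree d)"
    unfolding e_def by (simp only: mult.assoc flip: power_mult)
  finally show ?thesis
    by (simp add: res_base_def power_mult_distrib ac_simps flip: power_mult)
qed

text \<open>The closed form obeys the recursion of the resultants: \<open>c + 2 * k\<close> is
  \<open>c + 2 * m\<close> or \<open>2 * m - c\<close>, which preserves the gcd with
  \<open>m\<close> and the parity of the cofactors.\<close>

lemma res_value_reduction:
  assumes m: "m = k \<or> m = c + k" and "m > 0"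
  shows "res_value m (c + 2 * k) =
    (-1) ^ (Suc k * m * degree d) * res_base ^ (m * k) * res_value m c"
proof -
  define n where "n = c + 2 * k"
  have gcd_eq: "gcd m n = gcd m c"
  proof -
    have "gcd k (c + 2 * k) = gcd k c"
      using gcd_add_mult[of k 2 c] by (simp add: add.commute)
    moreover have "gcd (c + k) (c + 2 * k) = gcd (c + k) c"
      by (metis gcd_add1 gcd_add2 add.assoc add.commute gcd.commute mult_2)
    ultimately show ?thesis using m by (auto simp: n_def)
  qed
  define h where "h = gcd m c"
  have h: "h > 0" "h dvd m" "h dvd c" "h dvd n"
    using \<open>m > 0\<close> gcd_dvd2[of m n] by (simp_all add: h_def gcd_eq)
  obtain m' c' n' where *: "m = h * m'" "c = h * c'" "n = h * n'"
    using h(2-4) unfolding dvd_def by blast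
  have same: "odd_cofactors m n \<longleftrightarrow> odd m' \<and> odd n'"
    "odd_cofactors m c \<longleftrightarrow> odd m' \<and> odd c'"
    unfolding odd_cofactors_def gcd_eq h_def[symmetric] using h * by simp_all
  have "n' = c' + 2 * m' \<or> n' + c' = 2 * m'"
  proof -
    have "n = c + 2 * m \<or> n + c = 2 * m" using m by (auto simp: n_def)
    then have "h * n' = h * (c' + 2 * m') \<or> h * (n' + c') = h * (2 * m')"
      unfolding * by (simp add: algebra_simps)
    then show ?thesis using h(1) by simp
  qed
  then have par: "odd n' \<longleftrightarrow> odd c'" by presburger
  show ?thesis
  proof (cases "odd_cofactors m c")
    case True
    then show ?thesis using same par by (simp add: res_value_def n_def)
  next
    case False
    have "m * n div 2 = m * k + m * c div 2"
      unfolding n_def by (simp add: distrib_left mult.left_commute)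
    \<comment> \<open>If \<open>m\<close> is odd then \<open>c\<close> is even, which forces \<open>k\<close> to be odd: the sign is trivial.\<close>
    moreover have "even (Suc k * m * degree d)"
    proof (cases "even m")
      case False
      then have "even c" using \<open>\<not> odd_cofactors m c\<close> same * by simp
      then have "odd k" using m False by auto
      then show ?thesis by simp
    qed simp
    ultimately have "res_value m n =
        (-1) ^ (Suc k * m * degree d) * res_base ^ (m * k) * res_value m c"
      using False same par by (auto simp: res_value_def gcd_eq power_add simp del: mult_Suc even_mult_iff)
    then show ?thesis by (simp only: n_def)
  qed
qed

text \<open>Unless the value is 0, some cofactor is even; then \<open>m * n\<close> is even and the
  sign is trivial.\<close>

lemma res_value_swap: "res_value m n = (-1) ^ (m * degree d * (n * degree d)) * res_value n m"
proof (cases "odd_cofactors m n")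
  case True
  then show ?thesis by (simp add: res_value_def odd_cofactors_commute)
next
  case False
  then have "even (m * n)"
    unfolding odd_cofactors_def
    by (metis dvd_div_mult_self even_mult_iff gcd_dvd1 gcd_dvd2)
  then have "even (m * degree d * (n * degree d))" by auto
  then show ?thesis
    by (simp add: res_value_def odd_cofactors_commute[of m] gcd.commute[of m] mult.commute[of m])
qed

lemma resultant_V:
  assumes "m + n > 0"
  shows "resultant (V m) (V n) = res_value m n"
  using assms
proof (induction "m + n" arbitrary: m n rule: less_induct)
  case less
  have reduce: "resultant (V a) (V b) = res_value a b" if ab: "a + b = m + n" "0 < a" "a < b" for a b
  proof -
    \<comment> \<open>Here \<open>c\<close> is the distance between \<open>b\<close> and
      \<open>2 * a\<close>; \<open>k > 0\<close> makes it smaller than \<open>b\<close>, so the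
      index sum drops.\<close>
    obtain c k where ck: "b = c + 2 * k" "k > 0" "a = k \<or> a = c + k"
    proof (cases "2 * a \<le> b")
      case True
      then show thesis using that(1)[of "b - 2 * a" a] ab by simp
    next
      case False
      then show thesis using that(1)[of "2 * a - b" "b - a"] ab by simp
    qed
    have "resultant (V a) (V c) = res_value a c"
      using ck ab by (intro less.hyps) auto
    then show ?thesis
      using resultant_V_reduction[OF ck(3) ab(2)] res_value_reduction[OF ck(3) ab(2)] ck(1) by simp
  qed
  \<comment> \<open>At index 0 the polynomial is the constant 2, the gcd is the other index and the
    exponent of \<open>res_base\<close> is 0.\<close>
  consider "m = 0" | "n = 0" | "m = n" "m > 0" | "0 < m" "m < n" | "0 < n" "n < m" by linarith
  then show ?case
  proof cases
    case 1
    then show ?thesis using less.prems by (simp add: res_value_def odd_cofactors_def degree_V mult.commute)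
  next
    case 2
    then show ?thesis using less.prems by (simp add: res_value_def odd_cofactors_def degree_V mult.commute)
  next
    case 3
    have "degree (V m) > 0" using degree_V[of m] deg_less 3 by simp
    then show ?thesis
      using resultant_self_mult_right[of "V m" 1] 3 by (simp add: res_value_def odd_cofactors_def)
  next
    case 4
    then show ?thesis using reduce by simp
  next
    case 5
    then show ?thesis
      using reduce[of n m] resultant_swap[of "V m" "V n"] res_value_swap[of m n] by (simp add: degree_V)
  qed
qed

end
end
end

section \<open>Removal of the scaling factor\<close>

theorem theorem2:
  fixes p0 \<beta> \<rho> :: rat and p1 d g :: "rat poly" and \<alpha> :: int and \<eta> \<omega> m n :: nat
  assumes "lucas_type_data p0 p1 d g \<alpha>"
    and "\<beta> = lead_coeff d" and "\<eta> = degree d" and "\<omega> = degree g" and "\<rho> = resultant g d"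
    and "m > 0" and "n > 0"
  shows "resultant (lucas_seq p0 p1 d g m) (lucas_seq p0 p1 d g n) =
    (if multiplicity 2 n = multiplicity 2 m then 0
     else of_int \<alpha> powi (- int (\<eta> * (n + m))) * 2 ^ (\<eta> * gcd m n) *
          ((-1) ^ (\<eta> * \<omega>) * \<beta> ^ (2 * \<eta> - \<omega>) * \<rho>) ^ (n * m div 2))"
proof -
  define a :: rat where "a = of_int \<alpha>"
  have p0: "p0 \<noteq> 0" and a: "a = 2 / p0" and d: "d = Polynomial.smult a p1" and g: "g \<noteq> 0"
    and less: "degree g < degree d"
    using assms(1) by (auto simp: lucas_type_data_def a_def)
  have a0: "a \<noteq> 0" and ap0: "a * p0 = 2" using p0 a by simp_all
  let ?L = "lucas_seq p0 p1 d g"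
  have V: "lucas_seq 2 d d g i = Polynomial.smult a (?L i)" for i
    by (rule lucas_seq_scale[OF ap0 d])
  have deg: "degree (?L i) = i * \<eta>" for i
    using degree_V[OF less, of i] a0 assms(3) by (simp add: V)
  \<comment> \<open>Pulling \<open>a\<close> out of one argument costs the degree of the other,
    which is the source of the total exponent \<open>\<eta> * (n + m)\<close>.\<close>
  have "a ^ (m * \<eta>) * (a ^ (n * \<eta>) * resultant (?L m) (?L n)) = res_value d g m n"
    using resultant_V[OF less g, of m n] assms(6) a0
    by (simp add: V deg resultant_smult_left resultant_smult_right)
  moreover have "a ^ (\<eta> * (n + m)) = a ^ (m * \<eta>) * a ^ (n * \<eta>)"
    by (simp only: distrib_left power_add mult.commute)
  ultimately have "a ^ (\<eta> * (n + m)) * resultant (?L m) (?L n) = res_value d g m n"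
    by (simp only: mult.assoc)
  then have "res_value d g m n = a ^ (\<eta> * (n + m)) * resultant (?L m) (?L n)" ..
  moreover have "a ^ (\<eta> * (n + m)) \<noteq> 0" using a0 by simp
  ultimately have "resultant (?L m) (?L n) = a powi (- int (\<eta> * (n + m))) * res_value d g m n"
    by (simp only: power_int_minus power_int_of_nat left_inverse mult_1_left simp_thms
        flip: mult.assoc)
  then show ?thesis
    unfolding multiplicity_two_eq_iff[OF assms(6,7)] res_value_def res_base_def a_def assms(2-5)
      mult.commute[of n m]
    by (cases "odd_cofactors m n") (simp_all only: mult.assoc mult_zero_right if_True if_False)
qed

end
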